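(* Let $n,m\ge 1$ and $p\ge 2$ be integers and let $A$ be an $n\times m$ matrix with entries in $[p]=\{0,1,\ldots,p-1\}$. Then: (a) If $X_1,X_2,\ldots,X_s$ are $n\times n$ transposition matrices such that $$r(X_1X_2\cdots X_sA)<r(X_2X_3\cdots X_sA)<\cdots<r(X_{s-1}X_sA)<r(X_sA)<r(A),$$ then $c(X_1X_2\cdots X_sA)<c(A)$. (b) If $Y_1,Y_2,\ldots,Y_t$ are $m\times m$ transposition matrices such that $$c(AY_1Y_2\cdots Y_t)<c(AY_1Y_2\cdots Y_{t-1})<\cdots<c(AY_1Y_2)<c(AY_1)<c(A),$$ then $r(AY_1Y_2\cdots Y_t)<r(A)$.
   Context: For $A=(a_{ij})$ an $n\times m$ matrix with entries in $[p]$, put $x_i=\sum_{j=1}^m a_{ij}p^{m-j}$ ($i=1,\ldots,n$) and $y_j=\sum_{i=1}^n a_{ij}p^{n-i}$ ($j=1,\ldots,m$); i.e. $x_i$ is the integer whose base-$p$ digits are the entries of row $i$, and $y_j$ the integer whose base-$p$ digits are the entries of column $j$. Define the ordered tuples $r(A)=\langle x_1,\ldots,x_n\rangle$ and $c(A)=\langle y_1,\ldots,y_m\rangle$. Tuples of integers of the same length are compared with the lexicographic order, denoted $<$. A transposition matrix is a matrix obtained from the identity matrix by interchanging exactly two rows; multiplying a matrix on the left by an $n\times n$ transposition swaps two of its rows, multiplying on the right by an $m\times m$ transposition swaps two of its columns. *)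

theory Defs
  imports "Jordan_Normal_Form.Gauss_Jordan_Elimination" "HOL-Library.List_Lexorder"
begin

text \<open>Matrix indices are zero-based, so that the exponents \<open>m - j\<close> and \<open>n - i\<close>
  of the one-based convention become \<open>m - 1 - j\<close> and \<open>n - 1 - i\<close>.  The tuples are lists;
  \<open><\<close> on lists is the lexicographic order.\<close>

definition row_code :: "nat \<Rightarrow> nat mat \<Rightarrow> nat \<Rightarrow> nat" where
  "row_code p A i = (\<Sum>j<dim_col A. A $$ (i, j) * p ^ (dim_col A - 1 - j))"

definition col_code :: "nat \<Rightarrow> nat mat \<Rightarrow> nat \<Rightarrow> nat" where
  "col_code p A j = (\<Sum>i<dim_row A. A $$ (i, j) * p ^ (dim_row A - 1 - i))"

definition row_tuple :: "nat \<Rightarrow> nat mat \<Rightarrow> nat list" where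
  "row_tuple p A = map (row_code p A) [0..<dim_row A]"

definition col_tuple :: "nat \<Rightarrow> nat mat \<Rightarrow> nat list" where
  "col_tuple p A = map (col_code p A) [0..<dim_col A]"

definition transposition_mat :: "nat \<Rightarrow> nat mat \<Rightarrow> bool" where
  "transposition_mat n X \<longleftrightarrow>
    (\<exists>k l. k < n \<and> l < n \<and> k \<noteq> l \<and> X = swaprows k l (1\<^sub>m n))"

text \<open>For \<open>Xs = [X\<^sub>1, \<dots>, X\<^sub>s]\<close>, \<open>left_prod Xs A\<close> is \<open>X\<^sub>1 X\<^sub>2 \<dots> X\<^sub>s A\<close> and
  \<open>left_prod (drop i Xs) A\<close> is \<open>X\<^bsub>i+1\<^esub> \<dots> X\<^sub>s A\<close>; for \<open>Ys = [Y\<^sub>1, \<dots>, Y\<^sub>t]\<close>,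
  \<open>right_prod A Ys\<close> is \<open>A Y\<^sub>1 Y\<^sub>2 \<dots> Y\<^sub>t\<close> and \<open>right_prod A (take i Ys)\<close>
  is \<open>A Y\<^sub>1 \<dots> Y\<^sub>i\<close>.\<close>

definition left_prod :: "nat mat list \<Rightarrow> nat mat \<Rightarrow> nat mat" where
  "left_prod Xs A = foldr (*) Xs A"

definition right_prod :: "nat mat \<Rightarrow> nat mat list \<Rightarrow> nat mat" where
  "right_prod A Ys = foldl (*) A Ys"

end

theory Submission
  imports Defs
begin

text \<open>Swapping rows \<open>k < l\<close> decreases the row tuple exactly when row \<open>l\<close> is smaller than row \<open>k\<close>.
  In the first column \<open>j\<close> where these two rows differ, the swap moves the smaller digit to the more
  significant place \<open>k\<close>, while all columns before \<open>j\<close> are unchanged, so the column tuple decreases as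
  well. Single steps are chained by transitivity, and part (b) is part (a) for the transposed matrix.\<close>

section \<open>Lexicographic order and base-\<open>p\<close> expansions\<close>

text \<open>A common form for both comparisons in play: numbers by their digits, most significant
  first, and tuples by their entries. Only arguments below \<open>m\<close> matter.\<close>

definition lex_less :: "nat \<Rightarrow> (nat \<Rightarrow> nat) \<Rightarrow> (nat \<Rightarrow> nat) \<Rightarrow> bool" where
  "lex_less m f g \<longleftrightarrow> (\<exists>j<m. (\<forall>i<j. f i = g i) \<and> f j < g j)"

lemma lex_less_trichotomy:
  "lex_less m f g \<or> lex_less m g f \<or> (\<forall>i<m. f i = g i)"
proof (induction m)
  case (Suc m)
  then show ?case
    unfolding lex_less_def less_Suc_eq by (metis linorder_neqE_nat)
qed simp

text \<open>Horner's rule: a new last digit is the least significant one. This drives the induction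
  on the number of digits.\<close>

lemma digit_sum_Suc:
  fixes f :: "nat \<Rightarrow> nat"
  shows "(\<Sum>j<Suc m. f j * p ^ (Suc m - 1 - j)) = p * (\<Sum>j<m. f j * p ^ (m - 1 - j)) + f m"
proof -
  have "(\<Sum>j<m. f j * p ^ (m - j)) = (\<Sum>j<m. p * (f j * p ^ (m - 1 - j)))"
  proof (rule sum.cong)
    fix j assume "j \<in> {..<m}"
    then have "m - j = Suc (m - 1 - j)" by auto
    then show "f j * p ^ (m - j) = p * (f j * p ^ (m - 1 - j))" by simp
  qed simp
  then show ?thesis by (simp add: sum_distrib_left)
qed

text \<open>If the leading digits already decide, the leading parts differ by at least 1, which is
  worth \<open>p\<close> after the shift and outweighs the last digit \<open>f m < p\<close>.
  Otherwise the leading parts agree and the last digit decides.\<close>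

lemma digit_sum_less:
  assumes "lex_less m f g" and "\<forall>i<m. f i < p"
  shows "(\<Sum>j<m. f j * p ^ (m - 1 - j)) < (\<Sum>j<m. g j * p ^ (m - 1 - j))"
  using assms
proof (induction m)
  case 0
  then show ?case by (simp add: lex_less_def)
next
  case (Suc m)
  let ?F = "\<Sum>j<m. f j * p ^ (m - 1 - j)" and ?G = "\<Sum>j<m. g j * p ^ (m - 1 - j)"
  consider "lex_less m f g" | "\<forall>i<m. f i = g i" "f m < g m"
    using Suc.prems(1) unfolding lex_less_def less_Suc_eq by auto
  then have "p * ?F + f m < p * ?G + g m"
  proof cases
    case 1
    then have "Suc ?F \<le> ?G" using Suc by auto
    then have "p * Suc ?F \<le> p * ?G" by (rule mult_le_mono2)
    moreover have "f m < p" using Suc.prems(2) by simp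
    ultimately show ?thesis by simp
  next
    case 2
    then have "?F = ?G" by (intro sum.cong) auto
    with 2 show ?thesis by simp
  qed
  then show ?case unfolding digit_sum_Suc .
qed

lemma digit_sum_less_iff:
  assumes "\<forall>i<m. f i < p" and "\<forall>i<m. g i < p"
  shows "(\<Sum>j<m. f j * p ^ (m - 1 - j)) < (\<Sum>j<m. g j * p ^ (m - 1 - j)) \<longleftrightarrow> lex_less m f g"
    (is "?F < ?G \<longleftrightarrow> _")
proof
  assume less: "?F < ?G"
  have "\<not> lex_less m g f" using digit_sum_less[of m g f p] assms less by auto
  moreover have "?F = ?G" if "\<forall>i<m. f i = g i" using that by (intro sum.cong) auto
  \<comment> \<open>The two other cases of the trichotomy would give \<open>?G < ?F\<close> or
    \<open>?F = ?G\<close>.\<close>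
  ultimately show "lex_less m f g" using lex_less_trichotomy[of m f g] less by auto
qed (use digit_sum_less assms in blast)

lemma map_upt_less_iff:
  fixes f g :: "nat \<Rightarrow> nat"
  shows "map f [0..<n] < map g [0..<n] \<longleftrightarrow> lex_less n f g"
proof -
  have "take i (map f [0..<n]) = take i (map g [0..<n]) \<longleftrightarrow> (\<forall>j<i. f j = g j)" if "i < n" for i
    using that by (auto simp: take_map)
  \<comment> \<open>The lists have equal length, so neither is a proper prefix of the other and only
    a first differing index remains.\<close>
  then show ?thesis
    by (auto simp: list_less_def lexord_take_index_conv lex_less_def)
qed

section \<open>Digit matrices, transposes and transposition matrices\<close>

definition digit_mat :: "nat \<Rightarrow> nat \<Rightarrow> nat \<Rightarrow> nat mat \<Rightarrow> bool" where
  "digit_mat p n m A \<longleftrightarrow> A \<in> carrier_mat n m \<and> (\<forall>i<n. \<forall>j<m. A $$ (i, j) < p)"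

lemma row_tuple_less_iff:
  assumes "A \<in> carrier_mat n m" and "B \<in> carrier_mat n m"
  shows "row_tuple p B < row_tuple p A \<longleftrightarrow> lex_less n (row_code p B) (row_code p A)"
  using assms by (simp add: row_tuple_def map_upt_less_iff)

lemma row_code_less_iff:
  assumes "digit_mat p n m A" and "k < n" and "l < n"
  shows "row_code p A k < row_code p A l \<longleftrightarrow> lex_less m (\<lambda>j. A $$ (k, j)) (\<lambda>j. A $$ (l, j))"
  using assms digit_sum_less_iff[of m "\<lambda>j. A $$ (k, j)" p "\<lambda>j. A $$ (l, j)"]
  by (auto simp: row_code_def digit_mat_def)

lemma row_code_transpose: "j < dim_col A \<Longrightarrow> row_code p (transpose_mat A) j = col_code p A j"
  by (simp add: row_code_def col_code_def)

lemma row_tuple_transpose: "row_tuple p (transpose_mat A) = col_tuple p A"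
  by (simp add: row_tuple_def col_tuple_def row_code_transpose)

lemma col_tuple_transpose: "col_tuple p (transpose_mat A) = row_tuple p A"
  by (metis row_tuple_transpose transpose_transpose)

lemma digit_mat_transpose: "digit_mat p n m A \<Longrightarrow> digit_mat p m n (transpose_mat A)"
  by (auto simp: digit_mat_def)

lemma swaprows_one_mult:
  fixes A :: "'a :: semiring_1 mat"
  assumes "A \<in> carrier_mat n m" and "k < n" and "l < n"
  shows "swaprows k l (1\<^sub>m n) * A = swaprows k l A"
  using swaprows_mat[OF assms] swaprows_mat[OF one_carrier_mat assms(2,3), where 'a = 'a] by simp

text \<open>A swap is symmetric in its two indices, so they can be ordered; then \<open>k\<close> is
  the more significant place in every column code.\<close>

lemma transposition_matE:
  assumes "transposition_mat n X"
  obtains k l where "k < l" and "l < n" and "X = swaprows k l (1\<^sub>m n)"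
proof -
  obtain k l where kl: "k < n" "l < n" "k \<noteq> l" "X = swaprows k l (1\<^sub>m n)"
    using assms by (auto simp: transposition_mat_def)
  have "swaprows k l (1\<^sub>m n) = swaprows l k (1\<^sub>m n)"
    by (rule eq_matI) (use kl in auto)
  then show thesis using kl that by (metis linorder_neqE_nat)
qed

text \<open>Lets a column swap on the right become, after transposing, a row swap on the left by the
  same matrix.\<close>

lemma transpose_transposition_mat:
  assumes "transposition_mat n X"
  shows "transpose_mat X = X"
proof -
  obtain k l where "k < l" "l < n" "X = swaprows k l (1\<^sub>m n)"
    using assms by (rule transposition_matE)
  then show ?thesis by (intro eq_matI) auto
qed

lemma transposition_mat_carrier: "transposition_mat n X \<Longrightarrow> X \<in> carrier_mat n n"
  by (auto simp: transposition_mat_def)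

lemma digit_mat_transposition_mult:
  assumes "digit_mat p n m A" and "transposition_mat n X"
  shows "digit_mat p n m (X * A)"
proof -
  obtain k l where kl: "k < l" "l < n" "X = swaprows k l (1\<^sub>m n)"
    using assms(2) by (rule transposition_matE)
  then have "X * A = swaprows k l A"
    using assms(1) by (auto simp: digit_mat_def intro: swaprows_one_mult)
  with kl assms(1) show ?thesis by (auto simp: digit_mat_def)
qed

section \<open>The effect of a single transposition\<close>

lemma col_tuple_transposition_mult_less:
  assumes A: "digit_mat p n m A" and X: "transposition_mat n X"
    and less: "row_tuple p (X * A) < row_tuple p A"
  shows "col_tuple p (X * A) < col_tuple p A"
proof -
  define B where "B = X * A"
  obtain k l where kl: "k < l" "l < n" "X = swaprows k l (1\<^sub>m n)"
    using X by (rule transposition_matE)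
  have cA: "A \<in> carrier_mat n m" using A by (simp add: digit_mat_def)
  have B: "B = swaprows k l A" using kl cA by (auto simp: B_def intro: swaprows_one_mult)
  have dB: "digit_mat p n m B" unfolding B_def by (rule digit_mat_transposition_mult[OF A X])
  have cB: "B \<in> carrier_mat n m" using dB by (simp add: digit_mat_def)
  have row_B: "row_code p B i = row_code p A (if i = k then l else if i = l then k else i)"
    if "i < n" for i
    using that kl cA by (auto simp: row_code_def B intro!: sum.cong)
  obtain i where i: "i < n" "\<forall>i'<i. row_code p B i' = row_code p A i'"
      "row_code p B i < row_code p A i"
    using less row_tuple_less_iff[OF cA cB] unfolding B_def lex_less_def by auto
  \<comment> \<open>The first difference \<open>i\<close> is \<open>k\<close> or \<open>l\<close>,
    as all other rows are unchanged. If it were \<open>l\<close>, the tuples would agree at the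
    earlier place \<open>k\<close>, so rows \<open>k\<close> and \<open>l\<close> would have equal
    codes, and the swap would change nothing at \<open>l\<close>. Hence
    \<open>i = k\<close>.\<close>
  have "row_code p A l < row_code p A k"
  proof (cases "i = l")
    case True
    then have "row_code p B k = row_code p A k" using i kl by blast
    then show ?thesis using i(3) True kl row_B[of k] row_B[of l] by simp
  next
    case False
    then show ?thesis using i row_B[of i] by (auto split: if_splits)
  qed
  then have "lex_less m (\<lambda>j. A $$ (l, j)) (\<lambda>j. A $$ (k, j))"
    using row_code_less_iff[OF A, of l k] kl by simp
  then obtain j where j: "j < m" "\<forall>j'<j. A $$ (l, j') = A $$ (k, j')" "A $$ (l, j) < A $$ (k, j)"
    unfolding lex_less_def by auto
  \<comment> \<open>Left of \<open>j\<close> the swapped rows have the same entries.\<close>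
  have "col_code p B j' = col_code p A j'" if "j' < j" for j'
    using that j kl cA by (auto simp: col_code_def B intro!: sum.cong)
  moreover have "col_code p B j < col_code p A j"
  proof -
    have "lex_less n (\<lambda>i. B $$ (i, j)) (\<lambda>i. A $$ (i, j))"
      unfolding lex_less_def
      \<comment> \<open>Since \<open>k < l\<close>, the entries of column \<open>j\<close> above
        \<open>k\<close> stay fixed, and the entry at \<open>k\<close> drops to
        \<open>A $$ (l, j)\<close>.\<close>
      by (rule exI[of _ k]) (use j kl cA in \<open>auto simp: B\<close>)
    moreover have "\<forall>i<n. B $$ (i, j) < p" using dB j by (simp add: digit_mat_def)
    ultimately show ?thesis
      using digit_sum_less[of n "\<lambda>i. B $$ (i, j)" "\<lambda>i. A $$ (i, j)" p] cA cB
      by (simp add: col_code_def)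
  qed
  ultimately have "lex_less m (col_code p B) (col_code p A)"
    using j(1) by (auto simp: lex_less_def)
  then show ?thesis using cA cB by (simp add: col_tuple_def map_upt_less_iff B_def)
qed

section \<open>Chains of transpositions\<close>

lemma digit_mat_left_prod:
  assumes "digit_mat p n m A" and "\<forall>X\<in>set Xs. transposition_mat n X"
  shows "digit_mat p n m (left_prod Xs A)"
  using assms(2)
  by (induction Xs) (auto simp: left_prod_def assms(1) digit_mat_transposition_mult)

lemma col_tuple_left_prod_less:
  assumes A: "digit_mat p n m A" and "Xs \<noteq> []" and "\<forall>X\<in>set Xs. transposition_mat n X"
    and "\<forall>i<length Xs. row_tuple p (left_prod (drop i Xs) A)
                        < row_tuple p (left_prod (drop (Suc i) Xs) A)"
  shows "col_tuple p (left_prod Xs A) < col_tuple p A"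
  using assms(2-)
proof (induction Xs)
  case (Cons X Xs)
  let ?B = "left_prod Xs A"
  have B: "digit_mat p n m ?B" using Cons.prems by (auto intro: digit_mat_left_prod A)
  have XB: "left_prod (X # Xs) A = X * ?B" by (simp add: left_prod_def)
  \<comment> \<open>The head of the list is the factor applied last, so the comparison at index 0
    concerns it alone; the comparisons at \<open>Suc i\<close> form the chain for the tail.\<close>
  have "row_tuple p (X * ?B) < row_tuple p ?B"
    using Cons.prems(3)[rule_format, of 0] XB by simp
  then have step: "col_tuple p (X * ?B) < col_tuple p ?B"
    using Cons.prems by (intro col_tuple_transposition_mult_less[OF B]) auto
  show ?case
  proof (cases "Xs = []")
    case True
    then show ?thesis using step by (simp add: left_prod_def)
  next
    case False
    have "row_tuple p (left_prod (drop i Xs) A) < row_tuple p (left_prod (drop (Suc i) Xs) A)"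
      if "i < length Xs" for i
      using Cons.prems(3)[rule_format, of "Suc i"] that by simp
    then have "col_tuple p ?B < col_tuple p A" using Cons False by auto
    with step XB show ?thesis by simp
  qed
qed simp

text \<open>Transposing reverses the order of the factors, and each factor is symmetric.\<close>

lemma transpose_right_prod:
  assumes "A \<in> carrier_mat n m" and "\<forall>Y\<in>set Ys. transposition_mat m Y"
  shows "transpose_mat (right_prod A Ys) = left_prod (rev Ys) (transpose_mat A)"
  using assms
proof (induction Ys arbitrary: A)
  case (Cons Y Ys)
  have Y: "Y \<in> carrier_mat m m" "transpose_mat Y = Y"
    using Cons.prems by (auto intro: transposition_mat_carrier transpose_transposition_mat)
  have "transpose_mat (right_prod A (Y # Ys)) = left_prod (rev Ys) (transpose_mat (A * Y))"
    using Cons Y by (simp add: right_prod_def)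
  also have "transpose_mat (A * Y) = Y * transpose_mat A"
    using transpose_mult[OF Cons.prems(1) Y(1)] Y(2) by simp
  finally show ?case by (simp add: left_prod_def)
qed (simp add: right_prod_def left_prod_def)

lemma row_tuple_right_prod_less:
  assumes A: "digit_mat p n m A" and "Ys \<noteq> []" and Ys: "\<forall>Y\<in>set Ys. transposition_mat m Y"
    and less: "\<forall>i<length Ys. col_tuple p (right_prod A (take (Suc i) Ys))
                        < col_tuple p (right_prod A (take i Ys))"
  shows "row_tuple p (right_prod A Ys) < row_tuple p A"
proof -
  have cA: "A \<in> carrier_mat n m" using A by (simp add: digit_mat_def)
  have tr: "transpose_mat (right_prod A (take i Ys)) = left_prod (rev (take i Ys)) (transpose_mat A)"
    for i
    using Ys by (intro transpose_right_prod[OF cA]) (auto dest: in_set_takeD)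
  \<comment> \<open>Reversing the list turns prefixes of \<open>Ys\<close> into suffixes of
    \<open>rev Ys\<close>, the shape that the result on left products expects.\<close>
  have col: "col_tuple p (right_prod A (take (length Ys - i) Ys))
      = row_tuple p (left_prod (drop i (rev Ys)) (transpose_mat A))" for i
    by (metis tr row_tuple_transpose drop_rev)
  have "row_tuple p (left_prod (drop i (rev Ys)) (transpose_mat A))
      < row_tuple p (left_prod (drop (Suc i) (rev Ys)) (transpose_mat A))"
    if "i < length (rev Ys)" for i
    \<comment> \<open>The chain is read backwards: \<open>Suc (length Ys - Suc i)\<close> equals
      \<open>length Ys - i\<close> because \<open>i < length Ys\<close>.\<close>
    using less[rule_format, of "length Ys - Suc i"] that
    by (simp add: Suc_diff_Suc flip: col)
  then have "col_tuple p (left_prod (rev Ys) (transpose_mat A)) < col_tuple p (transpose_mat A)"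
    using assms(2) Ys by (intro col_tuple_left_prod_less[OF digit_mat_transpose[OF A]]) auto
  then show ?thesis using tr[of "length Ys"] col_tuple_transpose by (metis order_refl take_all)
qed

theorem theorem1:
  fixes n m p :: nat and A :: "nat mat"
  assumes "n \<ge> 1" and "m \<ge> 1" and "p \<ge> 2"
    and "A \<in> carrier_mat n m"
    and "\<forall>i<n. \<forall>j<m. A $$ (i, j) \<in> {0..<p}"
  shows
    "(\<forall>Xs. Xs \<noteq> [] \<and> (\<forall>X\<in>set Xs. transposition_mat n X) \<and>
        (\<forall>i<length Xs. row_tuple p (left_prod (drop i Xs) A)
                        < row_tuple p (left_prod (drop (Suc i) Xs) A))
        \<longrightarrow> col_tuple p (left_prod Xs A) < col_tuple p A) \<and>
     (\<forall>Ys. Ys \<noteq> [] \<and> (\<forall>Y\<in>set Ys. transposition_mat m Y) \<and>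
        (\<forall>i<length Ys. col_tuple p (right_prod A (take (Suc i) Ys))
                        < col_tuple p (right_prod A (take i Ys)))
        \<longrightarrow> row_tuple p (right_prod A Ys) < row_tuple p A)"
proof -
  have "digit_mat p n m A" using assms by (auto simp: digit_mat_def)
  then show ?thesis using col_tuple_left_prod_less row_tuple_right_prod_less by blast
qed

end
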